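(* Let $n\ge 5$ and $r\ge n-4$ be integers, let $I_n=(x_ix_{i+1} : 1\le i\le n-1)\subseteq R_n$ be the edge ideal of the line graph (path) $L_n$ on $[n]$, and let $I_{n+r}:=\mathrm{Inc}(\mathbb{N})_{n,n+r}(I_n)\subseteq R_{n+r}$. Then the height of $I_{n+r}$ is $n+r-2$; equivalently, $\dim(R_{n+r}/I_{n+r})=2$.
   Context: Let $k$ be a field, $R_m=k[x_1,\dots,x_m]$ and $[m]=\{1,\dots,m\}$. For $n\le m$, $\mathrm{Inc}(\mathbb{N})_{n,m}$ is the set of strictly increasing functions $\pi:[n]\to[m]$; each such $\pi$ induces the $k$-algebra homomorphism $\pi:R_n\to R_m$, $x_i\mapsto x_{\pi(i)}$. For an ideal $I\subseteq R_n$, $\mathrm{Inc}(\mathbb{N})_{n,m}(I):=\sum_{\pi\in\mathrm{Inc}(\mathbb{N})_{n,m}}\pi(I)R_m$, the ideal of $R_m$ generated by the images of $I$ under all such $\pi$. The edge ideal of a simple graph $G$ on $[n]$ is $I(G)=(x_ix_j : \{i,j\}\in E(G))\subseteq R_n$. The line graph $L_n$ is the path on vertex set $[n]$ with edges $\{i,i+1\}$, $1\le i\le n-1$. Here $\dim$ denotes Krull dimension. *)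

theory Defs
  imports
    "HOL-Library.Poly_Mapping"
    "HOL-Library.Extended_Nat"
    "HOL-Library.FuncSet"
    "HOL-Algebra.QuotRing"
begin

section \<open>Polynomial rings in finitely many variables\<close>

text \<open>
  A monomial is a finitely supported exponent vector of type \<^typ>\<open>nat \<Rightarrow>\<^sub>0 nat\<close>, and a polynomial
  is a finitely supported family of coefficients indexed by monomials.  The product of
  \<^theory>\<open>HOL-Library.Poly_Mapping\<close> is the convolution product, i.e. polynomial multiplication in
  countably many variables; \<open>mpoly_ring m\<close> is its subring \<open>k[x\<^sub>1, \<dots>, x\<^sub>m]\<close>.
\<close>

type_synonym 'k mpol = "(nat \<Rightarrow>\<^sub>0 nat) \<Rightarrow>\<^sub>0 'k"

definition X :: "nat \<Rightarrow> 'k::comm_ring_1 mpol" where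
  "X i = Poly_Mapping.single (Poly_Mapping.single i 1) 1"

definition Const :: "'k::comm_ring_1 \<Rightarrow> 'k mpol" where
  "Const c = Poly_Mapping.single 0 c"

definition mpoly_ring :: "nat \<Rightarrow> 'k::field mpol ring" where
  "mpoly_ring m =
     \<lparr> carrier = {p. \<forall>t \<in> Poly_Mapping.keys p. Poly_Mapping.keys t \<subseteq> {1..m}},
       monoid.mult = (*), one = 1, ring.zero = 0, add = (+) \<rparr>"


section \<open>Krull dimension and height\<close>

definition prime_chain :: "('a, 'b) ring_scheme \<Rightarrow> nat \<Rightarrow> (nat \<Rightarrow> 'a set) \<Rightarrow> bool" where
  "prime_chain R d P \<longleftrightarrow> (\<forall>i\<le>d. primeideal (P i) R) \<and> (\<forall>i<d. P i \<subset> P (Suc i))"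

text \<open>
  The zero ring gets dimension \<open>0\<close> (the supremum of the empty set in \<^typ>\<open>enat\<close>), and the
  unit ideal gets height \<open>\<infinity>\<close>.
\<close>

definition krull_dim :: "('a, 'b) ring_scheme \<Rightarrow> enat" where
  "krull_dim R = (SUP d \<in> {d. \<exists>P. prime_chain R d P}. enat d)"

definition prime_height :: "('a, 'b) ring_scheme \<Rightarrow> 'a set \<Rightarrow> enat" where
  "prime_height R Q = (SUP d \<in> {d. \<exists>P. prime_chain R d P \<and> P d = Q}. enat d)"

definition ideal_height :: "('a, 'b) ring_scheme \<Rightarrow> 'a set \<Rightarrow> enat" where
  "ideal_height R I = (INF Q \<in> {Q. primeideal Q R \<and> I \<subseteq> Q}. prime_height R Q)"


section \<open>The action of increasing maps\<close>

definition Inc :: "nat \<Rightarrow> nat \<Rightarrow> (nat \<Rightarrow> nat) set" where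
  "Inc n m = {\<pi> \<in> {1..n} \<rightarrow>\<^sub>E {1..m}. strict_mono_on {1..n} \<pi>}"

definition subst_monom :: "(nat \<Rightarrow> nat) \<Rightarrow> (nat \<Rightarrow>\<^sub>0 nat) \<Rightarrow> 'k::comm_ring_1 mpol" where
  "subst_monom \<pi> t = (\<Prod>i \<in> Poly_Mapping.keys t. X (\<pi> i) ^ Poly_Mapping.lookup t i)"

definition subst_vars :: "(nat \<Rightarrow> nat) \<Rightarrow> 'k::comm_ring_1 mpol \<Rightarrow> 'k mpol" where
  "subst_vars \<pi> p =
     (\<Sum>t \<in> Poly_Mapping.keys p. Const (Poly_Mapping.lookup p t) * subst_monom \<pi> t)"

definition Inc_ideal :: "nat \<Rightarrow> nat \<Rightarrow> 'k::field mpol set \<Rightarrow> 'k mpol set" where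
  "Inc_ideal n m I = Idl\<^bsub>mpoly_ring m\<^esub> (\<Union>\<pi> \<in> Inc n m. subst_vars \<pi> ` I)"


section \<open>Edge ideals\<close>

text \<open>A simple graph on \<open>{1..n}\<close> is given by its set of edges, which are two-element subsets.\<close>

definition edge_ideal :: "nat \<Rightarrow> nat set set \<Rightarrow> 'k::field mpol set" where
  "edge_ideal n E = Idl\<^bsub>mpoly_ring n\<^esub> {X i * X j | i j. {i, j} \<in> E}"

definition line_graph :: "nat \<Rightarrow> nat set set" where
  "line_graph n = {{i, i + 1} | i. 1 \<le> i \<and> i \<le> n - 1}"


section \<open>Basic facts\<close>

lemma mpoly_ring_simps [simp]:
  "carrier (mpoly_ring m) = {p. \<forall>t \<in> Poly_Mapping.keys p. Poly_Mapping.keys t \<subseteq> {1..m}}"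
  "x \<otimes>\<^bsub>mpoly_ring m\<^esub> y = x * y" "x \<oplus>\<^bsub>mpoly_ring m\<^esub> y = x + y"
  "\<one>\<^bsub>mpoly_ring m\<^esub> = 1" "\<zero>\<^bsub>mpoly_ring m\<^esub> = 0"
  by (simp_all add: mpoly_ring_def)

lemma add_in_carrier_mpoly_ring:
  assumes "p \<in> carrier (mpoly_ring m)" "q \<in> carrier (mpoly_ring m)"
  shows "p + q \<in> carrier (mpoly_ring m)"
  using assms Poly_Mapping.keys_add[of p q] by auto

lemma mult_in_carrier_mpoly_ring:
  assumes "p \<in> carrier (mpoly_ring m)" "q \<in> carrier (mpoly_ring m)"
  shows "p * q \<in> carrier (mpoly_ring m)"
proof -
  have "Poly_Mapping.keys t \<subseteq> {1..m}" if t: "t \<in> Poly_Mapping.keys (p * q)" for t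
  proof -
    obtain a b where ab: "t = a + b" "a \<in> Poly_Mapping.keys p" "b \<in> Poly_Mapping.keys q"
      using t keys_mult[of p q] by blast
    then have "Poly_Mapping.keys a \<subseteq> {1..m}" "Poly_Mapping.keys b \<subseteq> {1..m}"
      using assms by auto
    then show ?thesis
      using ab(1) Poly_Mapping.keys_add[of a b] by blast
  qed
  then show ?thesis by simp
qed

lemma uminus_in_carrier_mpoly_ring:
  assumes "p \<in> carrier (mpoly_ring m)"
  shows "- p \<in> carrier (mpoly_ring m)"
  using assms by (auto simp: in_keys_iff)

lemma cring_mpoly_ring: "cring (mpoly_ring m :: 'k::field mpol ring)"
proof (rule cringI)
  show "abelian_group (mpoly_ring m :: 'k mpol ring)"
  proof (rule abelian_groupI)
    fix x :: "'k mpol" assume x: "x \<in> carrier (mpoly_ring m)"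
    show "\<exists>y\<in>carrier (mpoly_ring m). y \<oplus>\<^bsub>mpoly_ring m\<^esub> x = \<zero>\<^bsub>mpoly_ring m\<^esub>"
      by (rule bexI[OF _ uminus_in_carrier_mpoly_ring[OF x]]) simp
  next
    fix x y :: "'k mpol" assume "x \<in> carrier (mpoly_ring m)" "y \<in> carrier (mpoly_ring m)"
    then show "x \<oplus>\<^bsub>mpoly_ring m\<^esub> y \<in> carrier (mpoly_ring m)"
      using add_in_carrier_mpoly_ring[of x m y] unfolding mpoly_ring_simps by blast
  qed (auto simp: algebra_simps)
  show "comm_monoid (mpoly_ring m :: 'k mpol ring)"
  proof (rule comm_monoidI)
    fix x y :: "'k mpol" assume "x \<in> carrier (mpoly_ring m)" "y \<in> carrier (mpoly_ring m)"
    then show "x \<otimes>\<^bsub>mpoly_ring m\<^esub> y \<in> carrier (mpoly_ring m)"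
      using mult_in_carrier_mpoly_ring[of x m y] unfolding mpoly_ring_simps by blast
  qed (auto simp: algebra_simps)
qed (auto simp: algebra_simps)

lemma subst_monom_add: "subst_monom \<pi> (s + t) = subst_monom \<pi> s * subst_monom \<pi> t"
proof -
  let ?A = "Poly_Mapping.keys s \<union> Poly_Mapping.keys t"
  have *: "subst_monom \<pi> u = (\<Prod>i\<in>?A. X (\<pi> i) ^ Poly_Mapping.lookup u i)"
    if "Poly_Mapping.keys u \<subseteq> ?A" for u
    unfolding subst_monom_def
    by (rule prod.mono_neutral_left) (use that in \<open>auto simp: in_keys_iff\<close>)
  have "Poly_Mapping.keys (s + t) \<subseteq> ?A"
    by (rule Poly_Mapping.keys_add)
  then show ?thesis
    by (simp add: * lookup_add power_add prod.distrib)
qed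

lemma subst_vars_add: "subst_vars \<pi> (p + q) = subst_vars \<pi> p + subst_vars \<pi> q"
  unfolding subst_vars_def
  by (rule setsum_keys_plus_distrib) (simp_all add: Const_def single_add algebra_simps)

lemma subst_vars_zero [simp]: "subst_vars \<pi> 0 = 0"
  by (simp add: subst_vars_def)

lemma subst_vars_single:
  "subst_vars \<pi> (Poly_Mapping.single t c) = Const c * subst_monom \<pi> t"
  by (simp add: subst_vars_def Const_def)

lemma subst_vars_sum: "subst_vars \<pi> (\<Sum>x\<in>A. f x) = (\<Sum>x\<in>A. subst_vars \<pi> (f x))"
  by (induction A rule: infinite_finite_induct) (simp_all add: subst_vars_add)

lemma mpol_as_sum:
  "p = (\<Sum>t \<in> Poly_Mapping.keys p. Poly_Mapping.single t (Poly_Mapping.lookup p t))"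
  by (rule poly_mapping_eqI)
    (auto simp: lookup_sum lookup_single when_def in_keys_iff sum.delta')

lemma subst_vars_mult: "subst_vars \<pi> (p * q) = subst_vars \<pi> p * subst_vars \<pi> q"
proof -
  have *: "subst_vars \<pi> (Poly_Mapping.single s a * Poly_Mapping.single t b) =
      subst_vars \<pi> (Poly_Mapping.single s a) * subst_vars \<pi> (Poly_Mapping.single t b)" for s a t b
  proof -
    have "Const (a * b) = Const a * Const b"
      by (simp add: Const_def mult_single)
    then show ?thesis
      by (simp add: mult_single subst_vars_single subst_monom_add algebra_simps)
  qed
  define f where "f = (\<lambda>t. Poly_Mapping.single t (Poly_Mapping.lookup p t))"
  define g where "g = (\<lambda>t. Poly_Mapping.single t (Poly_Mapping.lookup q t))"
  have "p = sum f (Poly_Mapping.keys p)" "q = sum g (Poly_Mapping.keys q)"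
    unfolding f_def g_def by (rule mpol_as_sum)+
  moreover have "subst_vars \<pi> (sum f A * sum g B) = subst_vars \<pi> (sum f A) * subst_vars \<pi> (sum g B)"
    for A B
    unfolding sum_product subst_vars_sum f_def g_def by (simp add: *)
  ultimately show ?thesis by metis
qed

lemma subst_vars_X [simp]: "subst_vars \<pi> (X i) = X (\<pi> i)"
  by (simp add: X_def subst_vars_single Const_def subst_monom_def)

lemma subst_vars_Const [simp]: "subst_vars \<pi> (Const c) = Const c"
  by (simp add: Const_def subst_vars_single subst_monom_def)

lemma X_in_carrier_mpoly_ring: "i \<in> {1..m} \<Longrightarrow> X i \<in> carrier (mpoly_ring m)"
  by (simp add: X_def)

lemma subst_vars_in_carrier:
  fixes p :: "'k::field mpol"
  assumes "\<pi> \<in> Inc n m" "p \<in> carrier (mpoly_ring n)"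
  shows "subst_vars \<pi> p \<in> carrier (mpoly_ring m)"
proof -
  let ?C = "carrier (mpoly_ring m) :: 'k mpol set"
  have one: "1 \<in> ?C" and zero: "0 \<in> ?C" by simp_all
  have pow: "x ^ e \<in> ?C" if "x \<in> ?C" for x :: "'k mpol" and e
    by (induction e) (use one that mult_in_carrier_mpoly_ring in \<open>auto simp del: mpoly_ring_simps(1)\<close>)
  have prod: "(\<Prod>i\<in>A. f i) \<in> ?C" if "\<And>i. i \<in> A \<Longrightarrow> f i \<in> ?C" for A and f :: "nat \<Rightarrow> 'k mpol"
    using that
    by (induction A rule: infinite_finite_induct)
      (use one mult_in_carrier_mpoly_ring in \<open>auto simp del: mpoly_ring_simps(1)\<close>)
  have sum: "(\<Sum>i\<in>A. f i) \<in> ?C" if "\<And>i. i \<in> A \<Longrightarrow> f i \<in> ?C"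
    for A and f :: "(nat \<Rightarrow>\<^sub>0 nat) \<Rightarrow> 'k mpol"
    using that
    by (induction A rule: infinite_finite_induct)
      (use zero add_in_carrier_mpoly_ring in \<open>auto simp del: mpoly_ring_simps(1)\<close>)
  have "subst_monom \<pi> t \<in> ?C" if "t \<in> Poly_Mapping.keys p" for t
    unfolding subst_monom_def
  proof (rule prod, rule pow, rule X_in_carrier_mpoly_ring)
    fix i assume "i \<in> Poly_Mapping.keys t"
    then have "i \<in> {1..n}" using assms(2) that unfolding mpoly_ring_simps by blast
    then show "\<pi> i \<in> {1..m}" using assms(1) by (auto simp: Inc_def PiE_iff)
  qed
  moreover have "Const c \<in> ?C" for c
    by (simp add: Const_def)
  ultimately show ?thesis
    unfolding subst_vars_def by (intro sum mult_in_carrier_mpoly_ring)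
qed

lemma subst_vars_ring_hom:
  assumes "\<pi> \<in> Inc n m"
  shows "subst_vars \<pi> \<in> ring_hom (mpoly_ring n) (mpoly_ring m)"
proof (rule ring_hom_memI)
  show "subst_vars \<pi> \<one>\<^bsub>mpoly_ring n\<^esub> = \<one>\<^bsub>mpoly_ring m\<^esub>"
    using subst_vars_Const[of \<pi> 1] by (simp add: Const_def)
qed (use subst_vars_in_carrier[OF assms] in
    \<open>auto simp: subst_vars_add subst_vars_mult simp del: mpoly_ring_simps(1)\<close>)

lemma edge_ideal_line_graph:
  "(edge_ideal n (line_graph n) :: 'k::field mpol set) =
     Idl\<^bsub>mpoly_ring n\<^esub> {X i * X (i + 1) | i. 1 \<le> i \<and> i \<le> n - 1}"
proof -
  have "({X i * X j | i j. {i, j} \<in> line_graph n} :: 'k mpol set) =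
      {X i * X (i + 1) | i. 1 \<le> i \<and> i \<le> n - 1}" (is "?A = ?B")
  proof
    show "?A \<subseteq> ?B"
      by (auto simp: line_graph_def doubleton_eq_iff mult.commute)
    show "?B \<subseteq> ?A"
      by (auto simp: line_graph_def)
  qed
  then show ?thesis by (simp only: edge_ideal_def)
qed

end

theory Submission
  imports Defs
begin

text \<open>
  Put \<open>m = n + r\<close>.  Position \<open>i\<close> of the path can be moved to \<open>a\<close> and position \<open>i + 1\<close> to \<open>b > a\<close>
  by an increasing map as soon as \<open>i - 1\<close> values fit below \<open>a\<close> and \<open>n - i - 1\<close> values fit above \<open>b\<close>;
  some \<open>i\<close> achieves this exactly when \<open>b - a \<le> r + 1\<close>.  So \<open>J\<close> is the edge ideal of the graph joining
  all vertices of \<open>{1..m}\<close> at distance at most \<open>r + 1\<close>.  Three pairwise non-adjacent vertices would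
  need \<open>m \<ge> 2 r + 5\<close>, which \<open>r \<ge> n - 4\<close> excludes, whereas \<open>1\<close> and \<open>m\<close> are not adjacent.  Hence a prime
  containing \<open>J\<close> contains at least \<open>m - 2\<close> of the variables
  (\<open>many_variables_in_prime_above\<close>), and the variables other than \<open>x\<^sub>1\<close> and \<open>x\<^sub>m\<close> generate a prime
  containing \<open>J\<close> (\<open>line_orbit_subset_var_ideal\<close>).

  A chain of primes whose first member contains \<open>s\<close> variables can be prolonged downwards by \<open>s\<close> steps,
  through ideals generated by fewer and fewer of these variables (\<open>prime_chain_below\<close>).  Both claims
  follow from this and from the bound \<open>m\<close> on the length of a chain of primes in \<open>k[x\<^sub>1, \<dots>, x\<^sub>m]\<close>
  (\<open>prime_chain_length_le\<close>).  A chain of length \<open>d\<close> above \<open>J\<close> prolongs downwards to one of length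
  \<open>d + (m - 2)\<close>, which gives the lower bound for the height and, as \<open>d + (m - 2) \<le> m\<close>, the upper bound
  for the dimension.  Conversely a chain ending in the ideal of all variables but \<open>x\<^sub>1\<close> and \<open>x\<^sub>m\<close>
  prolongs upwards by two steps, so its length is at most \<open>m - 2\<close>; these same two steps show that the
  dimension is at least \<open>2\<close>.

  The bound on chains is obtained without Noether normalization, by comparing two facts.  If
  \<open>P\<^sub>0 \<subset> \<dots> \<subset> P\<^sub>d\<close> are primes and \<open>a\<^sub>i\<close> lies in \<open>P\<^sub>i\<close> but not in \<open>P\<^sub>i\<^sub>-\<^sub>1\<close>, then \<open>a\<^sub>1, \<dots>, a\<^sub>d\<close> are
  algebraically independent over \<open>k\<close>, even modulo \<open>P\<^sub>0\<close>
  (\<open>chain_elements_algebraically_independent\<close>, an argument in the style of Coquand and Lombardi).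
  But \<open>m + 1\<close> polynomials in \<open>m\<close> variables are algebraically dependent, because they have too many
  monomials (\<open>algebraic_dependence\<close>).
\<close>

section \<open>Chains of primes and quotients\<close>

lemma prime_chain_subset:
  assumes "prime_chain R d P" "i \<le> j" "j \<le> d"
  shows "P i \<subseteq> P j"
  using assms(2,3)
proof (induction j rule: dec_induct)
  case (step j)
  then show ?case
    using assms(1) unfolding prime_chain_def by (meson Suc_le_lessD dual_order.trans less_imp_le psubset_imp_subset)
qed simp

lemma carrier_quot: "carrier (R Quot J) = (\<lambda>x. J +>\<^bsub>R\<^esub> x) ` carrier R"
  by (auto simp: FactRing_def A_RCOSETS_def')

lemma (in cring) primeideal_quot_image:
  assumes J: "ideal J R" and P: "primeideal P R" and "J \<subseteq> P"
  shows "primeideal ((+>) J ` P) (R Quot J)"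
proof -
  interpret J: ideal J R by fact
  interpret P: primeideal P R by fact
  have PU: "P = (\<Union>j\<in>P. J +> j)"
    using ideal_incl_iff[OF J P.is_ideal] \<open>J \<subseteq> P\<close> by blast
  have mem: "J +> x \<in> (+>) J ` P \<longleftrightarrow> x \<in> P" if "x \<in> carrier R" for x
    using PU J.a_rcos_self[OF that] by blast
  note carr = carrier_quot[of R J]
  show ?thesis
  proof (rule primeidealI)
    show "ideal ((+>) J ` P) (R Quot J)"
      by (rule ring_ideal_imp_quot_ideal[OF J P.is_ideal])
    show "cring (R Quot J)"
      using J.quotient_is_cring is_cring by blast
    show "carrier (R Quot J) \<noteq> (+>) J ` P"
    proof
      assume eq: "carrier (R Quot J) = (+>) J ` P"
      have "x \<in> P" if "x \<in> carrier R" for x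
        using mem[OF that] that unfolding eq[symmetric] carr by simp
      then show False using P.I_notcarr P.a_subset by auto
    qed
  next
    fix a b assume "a \<in> carrier (R Quot J)" "b \<in> carrier (R Quot J)"
      and ab: "a \<otimes>\<^bsub>R Quot J\<^esub> b \<in> (+>) J ` P"
    then obtain x y where xy: "x \<in> carrier R" "y \<in> carrier R" "a = J +> x" "b = J +> y"
      unfolding carr by blast
    then have "J +> (x \<otimes> y) \<in> (+>) J ` P"
      using ab J.rcoset_mult_add by (simp add: FactRing_def)
    then show "a \<in> (+>) J ` P \<or> b \<in> (+>) J ` P"
      using mem xy P.I_prime by (meson m_closed)
  qed
qed

text \<open>
  Primes of a quotient are the primes above the ideal; taking preimages and images under the
  projection preserves strictness because the projection is onto and \<open>P\<close> is the union of the cosets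
  \<open>J + x\<close> for \<open>x \<in> P\<close>.
\<close>

lemma (in cring) prime_chain_quot_iff:
  assumes J: "ideal J R"
  shows "(\<exists>P. prime_chain (R Quot J) d P) \<longleftrightarrow> (\<exists>P. prime_chain R d P \<and> J \<subseteq> P 0)"
proof
  interpret J: ideal J R by fact
  interpret h: ring_hom_ring R "R Quot J" "(+>) J" by (rule J.rcos_ring_hom_ring)
  note carr = carrier_quot[of R J]
  {
    assume "\<exists>P. prime_chain (R Quot J) d P"
    then obtain P where P: "prime_chain (R Quot J) d P" ..
    define Q where "Q i = {x \<in> carrier R. J +> x \<in> P i}" for i
    have "primeideal (Q i) R" if "i \<le> d" for i
      unfolding Q_def by (rule h.primeideal_vimage[OF is_cring])
        (use P that in \<open>auto simp: prime_chain_def\<close>)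
    moreover have "Q i \<subset> Q (Suc i)" if "i < d" for i
    proof -
      have sub: "P i \<subset> P (Suc i)" using P that by (simp add: prime_chain_def)
      then obtain c where c: "c \<in> P (Suc i)" "c \<notin> P i" by blast
      have "primeideal (P (Suc i)) (R Quot J)"
        using P that by (simp add: prime_chain_def)
      then have "P (Suc i) \<subseteq> carrier (R Quot J)"
        by (meson additive_subgroup.a_subset ideal.axioms(1) primeideal.axioms(1))
      then obtain x where "x \<in> carrier R" "c = J +> x"
        using c unfolding carr by blast
      then show ?thesis using c sub unfolding Q_def by blast
    qed
    moreover have "J \<subseteq> Q 0"
    proof
      fix x assume x: "x \<in> J"
      have "primeideal (P 0) (R Quot J)" using P by (simp add: prime_chain_def)
      then have "\<zero>\<^bsub>R Quot J\<^esub> \<in> P 0"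
        by (meson additive_subgroup.zero_closed ideal.axioms(1) primeideal.axioms(1))
      moreover have "J +> x = \<zero>\<^bsub>R Quot J\<^esub>"
        using J.a_rcos_const[OF x] by (simp only: FactRing_def ring.simps)
      ultimately show "x \<in> Q 0" using J.a_Hcarr[OF x] by (simp add: Q_def)
    qed
    ultimately have "prime_chain R d Q \<and> J \<subseteq> Q 0"
      by (simp add: prime_chain_def)
    then show "\<exists>P. prime_chain R d P \<and> J \<subseteq> P 0" by (intro exI[of _ Q])
  }
  {
    assume "\<exists>P. prime_chain R d P \<and> J \<subseteq> P 0"
    then obtain P where P: "prime_chain R d P" "J \<subseteq> P 0" by blast
    have prime: "primeideal (P i) R" and above: "J \<subseteq> P i" if "i \<le> d" for i
      using P(1) that prime_chain_subset[OF P(1), of 0 i] P(2)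
      by (auto simp: prime_chain_def)
    have U: "\<Union> ((+>) J ` P i) = P i" if "i \<le> d" for i
      using ideal_incl_iff[OF J, of "P i"] prime[OF that] above[OF that]
      by (simp add: primeideal.axioms(1))
    have "(+>) J ` P i \<subset> (+>) J ` P (Suc i)" if "i < d" for i
    proof -
      have "P i \<subset> P (Suc i)" using P(1) that by (simp add: prime_chain_def)
      moreover from this have "(+>) J ` P i \<noteq> (+>) J ` P (Suc i)"
        using U[of i] U[of "Suc i"] that by (metis Suc_leI less_imp_le psubset_eq)
      ultimately show ?thesis by blast
    qed
    then have "prime_chain (R Quot J) d (\<lambda>i. (+>) J ` P i)"
      unfolding prime_chain_def using primeideal_quot_image[OF J prime above] by blast
    then show "\<exists>P. prime_chain (R Quot J) d P" by blast
  }
qed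

section \<open>Algebraic dependence\<close>

lemma Const_add: "Const (a + b) = Const a + Const b"
  by (simp add: Const_def single_add)

lemma Const_mult: "Const (a * b) = Const a * Const b"
  by (simp add: Const_def mult_single)

lemma Const_1: "Const 1 = 1"
  by (simp add: Const_def)

lemma Const_in_carrier: "Const c \<in> carrier (mpoly_ring m)"
  by (simp add: Const_def)

lemma vector_space_mpol: "vector_space (\<lambda>(c::'k::field) p. Const c * p)"
  by unfold_locales (simp_all add: Const_add Const_mult Const_1 algebra_simps)

text \<open>
  The family \<open>M\<close> may have repetitions, and then two equal members already give a relation; a
  relation indexed by \<open>F\<close>, and not by the set of values, is what \<open>algebraic_dependence\<close> needs.
\<close>

lemma linear_dependence_of_many:
  fixes M :: "'i \<Rightarrow> 'k::field mpol"
  assumes "finite F" "finite T" "\<And>e. e \<in> F \<Longrightarrow> Poly_Mapping.keys (M e) \<subseteq> T"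
    and "card T < card F"
  obtains c where "\<exists>e\<in>F. c e \<noteq> 0" "(\<Sum>e\<in>F. Const (c e) * M e) = 0"
proof -
  interpret vector_space "\<lambda>(c::'k) p. Const c * p" by (rule vector_space_mpol)
  show thesis
  proof (cases "inj_on M F")
    case False
    then obtain e e' where e: "e \<in> F" "e' \<in> F" "e \<noteq> e'" "M e = M e'"
      by (auto simp: inj_on_def)
    let ?c = "\<lambda>x. if x = e then 1 else if x = e' then - 1 else (0::'k)"
    have "(\<Sum>x\<in>F. Const (?c x) * M x) = (\<Sum>x\<in>{e, e'}. Const (?c x) * M x)"
      by (rule sum.mono_neutral_right) (use e assms(1) in \<open>auto simp: Const_def\<close>)
    also have "\<dots> = 0"
      using e by (simp add: Const_def single_uminus)
    finally show thesis
      using e by (intro that[of ?c]) auto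
  next
    case True
    define B where "B = (\<lambda>t. Poly_Mapping.single t (1::'k)) ` T"
    have "M ` F \<subseteq> span B"
    proof
      fix p assume "p \<in> M ` F"
      then have keys: "Poly_Mapping.keys p \<subseteq> T" using assms(3) by blast
      have "p = (\<Sum>t\<in>Poly_Mapping.keys p.
          Const (Poly_Mapping.lookup p t) * Poly_Mapping.single t 1)"
        by (subst mpol_as_sum) (simp add: Const_def mult_single)
      also have "\<dots> \<in> span B"
        by (intro span_sum span_scale span_base) (use keys in \<open>auto simp: B_def\<close>)
      finally show "p \<in> span B" .
    qed
    moreover have "card B < card (M ` F)"
      using card_image_le[OF assms(2), of "\<lambda>t. Poly_Mapping.single t (1::'k)"] assms(4)
        card_image[OF True] by (simp add: B_def)
    ultimately have "dependent (M ` F)"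
      using independent_span_bound[of B "M ` F"] assms(2) by (auto simp: B_def)
    then obtain u where u: "\<exists>v\<in>M ` F. u v \<noteq> 0" "(\<Sum>v\<in>M ` F. Const (u v) * v) = 0"
      using dependent_finite[of "M ` F"] assms(1) by auto
    then show thesis
      using sum.reindex[OF True, of "\<lambda>v. Const (u v) * v"]
      by (intro that[of "\<lambda>e. u (M e)"]) (auto simp: o_def)
  qed
qed

lemma card_box_monomials:
  defines "T m B \<equiv> {t :: nat \<Rightarrow>\<^sub>0 nat. Poly_Mapping.keys t \<subseteq> {1..m} \<and> (\<forall>j. Poly_Mapping.lookup t j \<le> B)}"
  shows "finite (T m B)" "card (T m B) \<le> (B + 1) ^ m"
proof -
  let ?f = "\<lambda>t. restrict (Poly_Mapping.lookup t) {1..m}"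
  have inj: "inj_on ?f (T m B)"
  proof (rule inj_onI, rule poly_mapping_eqI)
    fix s t j assume st: "s \<in> T m B" "t \<in> T m B" and eq: "?f s = ?f t"
    show "Poly_Mapping.lookup s j = Poly_Mapping.lookup t j"
    proof (cases "j \<in> {1..m}")
      case True then show ?thesis using fun_cong[OF eq, of j] by simp
    next
      case False
      then have "j \<notin> Poly_Mapping.keys s" "j \<notin> Poly_Mapping.keys t"
        using st unfolding T_def by blast+
      then show ?thesis by (simp add: in_keys_iff)
    qed
  qed
  have sub: "?f ` T m B \<subseteq> {1..m} \<rightarrow>\<^sub>E {..B}"
    by (auto simp: T_def)
  have fin: "finite ({1..m} \<rightarrow>\<^sub>E {..B})" by (intro finite_PiE) auto
  show "finite (T m B)" using inj sub fin by (meson finite_imageD finite_subset)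
  show "card (T m B) \<le> (B + 1) ^ m"
    using card_inj_on_le[OF inj sub fin] by (simp add: card_funcsetE)
qed

text \<open>
  The bound is on each exponent separately instead of on the total degree: the monomials under it
  form a box, which is easy to count, and the bound is still additive under products.
\<close>

definition exp_bounded :: "nat \<Rightarrow> 'k::zero mpol \<Rightarrow> bool" where
  "exp_bounded B p \<longleftrightarrow> (\<forall>t\<in>Poly_Mapping.keys p. \<forall>j. Poly_Mapping.lookup t j \<le> B)"

lemma exp_bounded_exists: "\<exists>B. exp_bounded B p"
proof -
  have "exp_bounded (\<Sum>t\<in>Poly_Mapping.keys p. \<Sum>j\<in>Poly_Mapping.keys t. Poly_Mapping.lookup t j) p"
    unfolding exp_bounded_def
  proof (intro ballI allI)
    fix t j assume t: "t \<in> Poly_Mapping.keys p"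
    have "Poly_Mapping.lookup t j \<le> (\<Sum>j\<in>Poly_Mapping.keys t. Poly_Mapping.lookup t j)"
      by (cases "j \<in> Poly_Mapping.keys t") (auto intro: member_le_sum simp: in_keys_iff)
    also have "\<dots> \<le> (\<Sum>t\<in>Poly_Mapping.keys p. \<Sum>j\<in>Poly_Mapping.keys t. Poly_Mapping.lookup t j)"
      using t by (intro member_le_sum[where f = "\<lambda>t. \<Sum>j\<in>Poly_Mapping.keys t. Poly_Mapping.lookup t j"]) auto
    finally show "Poly_Mapping.lookup t j \<le> \<dots>" .
  qed
  then show ?thesis ..
qed

lemma exp_bounded_mono: "exp_bounded A p \<Longrightarrow> A \<le> B \<Longrightarrow> exp_bounded B p"
  unfolding exp_bounded_def by (meson order.trans)

lemma exp_bounded_mult: "exp_bounded A p \<Longrightarrow> exp_bounded B q \<Longrightarrow> exp_bounded (A + B) (p * q)"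
  unfolding exp_bounded_def using keys_mult[of p q] by (force simp: lookup_add intro: add_mono)

lemma exp_bounded_1: "exp_bounded 0 (1 :: 'k::zero_neq_one mpol)"
  by (simp add: exp_bounded_def)

lemma exp_bounded_power:
  "exp_bounded B p \<Longrightarrow> exp_bounded (e * B) (p ^ e)" for p :: "'k::comm_ring_1 mpol"
  by (induction e) (auto simp: exp_bounded_1 intro: exp_bounded_mult)

lemma exp_bounded_prod:
  fixes f :: "'i \<Rightarrow> 'k::comm_ring_1 mpol"
  assumes "\<And>i. i \<in> A \<Longrightarrow> exp_bounded B (f i)"
  shows "exp_bounded (card A * B) (\<Prod>i\<in>A. f i)"
  using assms
  by (induction A rule: infinite_finite_induct) (auto simp: exp_bounded_1 intro: exp_bounded_mult)

lemma one_in_carrier_mpoly_ring: "1 \<in> carrier (mpoly_ring m)"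
  by simp

lemma power_in_carrier_mpoly_ring:
  "p \<in> carrier (mpoly_ring m) \<Longrightarrow> p ^ e \<in> carrier (mpoly_ring m)"
  by (induction e)
    (auto intro: one_in_carrier_mpoly_ring mult_in_carrier_mpoly_ring simp del: mpoly_ring_simps(1))

lemma prod_in_carrier_mpoly_ring:
  "(\<And>i. i \<in> A \<Longrightarrow> f i \<in> carrier (mpoly_ring m)) \<Longrightarrow> (\<Prod>i\<in>A. f i) \<in> carrier (mpoly_ring m)"
  by (induction A rule: infinite_finite_induct)
    (auto intro: one_in_carrier_mpoly_ring mult_in_carrier_mpoly_ring simp del: mpoly_ring_simps(1))

lemma sum_in_carrier_mpoly_ring:
  "(\<And>i. i \<in> A \<Longrightarrow> f i \<in> carrier (mpoly_ring m)) \<Longrightarrow> (\<Sum>i\<in>A. f i) \<in> carrier (mpoly_ring m)"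
proof (induction A rule: infinite_finite_induct)
  case (insert x F)
  then show ?case using add_in_carrier_mpoly_ring by (auto simp del: mpoly_ring_simps(1))
qed auto

text \<open>
  The products \<open>\<Prod>i. a i ^ e i\<close> with all \<open>e i < N\<close> are indexed by \<open>N ^ (m + 1)\<close> exponent vectors, but
  their monomials lie in a box with only \<open>O(N ^ m)\<close> elements; so for large \<open>N\<close> they satisfy a linear
  relation.  The relation is recorded by its support \<open>E\<close> and its coefficients \<open>c\<close>; the injectivity
  clause says that different members of \<open>E\<close> are different exponent vectors, since they are functions
  on all of \<^typ>\<open>nat\<close>.
\<close>

lemma algebraic_dependence:
  fixes a :: "nat \<Rightarrow> 'k::field mpol"
  assumes a: "\<And>i. i \<in> {1..Suc m} \<Longrightarrow> a i \<in> carrier (mpoly_ring m)"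
  obtains E :: "(nat \<Rightarrow> nat) set" and c where
    "finite E" "E \<noteq> {}" "inj_on (\<lambda>e. restrict e {1..Suc m}) E" "\<forall>e\<in>E. c e \<noteq> 0"
    "(\<Sum>e\<in>E. Const (c e) * (\<Prod>i\<in>{1..Suc m}. a i ^ e i)) = 0"
proof -
  have "\<forall>i. \<exists>B. exp_bounded B (a i)"
    using exp_bounded_exists by blast
  then obtain D where D: "exp_bounded (D i) (a i)" for i
    by metis
  define d where "d = (\<Sum>i\<in>{1..Suc m}. D i)"
  have d: "exp_bounded d (a i)" if "i \<in> {1..Suc m}" for i
    using exp_bounded_mono[OF D] member_le_sum[of i "{1..Suc m}" D] that unfolding d_def by auto
  \<comment> \<open>The box has side \<open>B + 1 \<le> C * N\<close>, hence at most \<open>C ^ m * N ^ m\<close> elements, which is less than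
    \<open>N ^ (m + 1)\<close> as soon as \<open>N > C ^ m\<close>.\<close>
  define C where "C = Suc m * d + 1"
  define N where "N = C ^ m + 1"
  define B where "B = Suc m * (N * d)"
  define F where "F = {1..Suc m} \<rightarrow>\<^sub>E {..<N}"
  define T where "T = {t :: nat \<Rightarrow>\<^sub>0 nat. Poly_Mapping.keys t \<subseteq> {1..m} \<and> (\<forall>j. Poly_Mapping.lookup t j \<le> B)}"
  define M where "M e = (\<Prod>i\<in>{1..Suc m}. a i ^ e i)" for e
  have finF: "finite F" unfolding F_def by (intro finite_PiE) auto
  have "B + 1 \<le> C * N"
    by (simp add: B_def C_def algebra_simps N_def)
  then have "(B + 1) ^ m \<le> C ^ m * N ^ m"
    by (metis power_mono power_mult_distrib zero_le)
  also have "\<dots> < N * N ^ m"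
    by (intro mult_strict_right_mono) (auto simp: N_def)
  finally have cardT: "card T < card F"
    using card_box_monomials(2)[of m B] by (simp add: F_def T_def card_funcsetE)
  have keysT: "Poly_Mapping.keys (M e) \<subseteq> T" if "e \<in> F" for e
  proof -
    have "exp_bounded (N * d) (a i ^ e i)" if "i \<in> {1..Suc m}" for i
    proof -
      have "e i \<le> N" using \<open>e \<in> F\<close> that unfolding F_def by (metis PiE_mem lessThan_iff less_imp_le)
      then show ?thesis
        using exp_bounded_mono[OF exp_bounded_power[OF d[OF that]]] by simp
    qed
    then have "exp_bounded (card {1..Suc m} * (N * d)) (M e)"
      unfolding M_def by (rule exp_bounded_prod)
    then have "exp_bounded B (M e)" by (simp add: B_def)
    moreover have "M e \<in> carrier (mpoly_ring m)"
      unfolding M_def by (intro prod_in_carrier_mpoly_ring power_in_carrier_mpoly_ring a)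
    ultimately show ?thesis
      unfolding T_def exp_bounded_def by auto
  qed
  have finT: "finite T" unfolding T_def by (rule card_box_monomials)
  obtain c where c: "\<exists>e\<in>F. c e \<noteq> 0" "(\<Sum>e\<in>F. Const (c e) * M e) = 0"
    by (rule linear_dependence_of_many[OF finF finT keysT cardT])
  show thesis
  proof (rule that)
    show "finite {e \<in> F. c e \<noteq> 0}" "{e \<in> F. c e \<noteq> 0} \<noteq> {}" using c(1) finF by auto
    show "\<forall>e\<in>{e \<in> F. c e \<noteq> 0}. c e \<noteq> 0" by simp
    show "inj_on (\<lambda>e. restrict e {1..Suc m}) {e \<in> F. c e \<noteq> 0}"
    proof (rule inj_onI)
      fix e e' assume e: "e \<in> {e \<in> F. c e \<noteq> 0}" "e' \<in> {e \<in> F. c e \<noteq> 0}"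
        and "restrict e {1..Suc m} = restrict e' {1..Suc m}"
      then show "e = e'" unfolding F_def by (metis (no_types, lifting) PiE_restrict mem_Collect_eq)
    qed
    have "(\<Sum>e\<in>{e \<in> F. c e \<noteq> 0}. Const (c e) * M e) = (\<Sum>e\<in>F. Const (c e) * M e)"
      by (rule sum.mono_neutral_left) (use finF in \<open>auto simp: Const_def\<close>)
    then show "(\<Sum>e\<in>{e \<in> F. c e \<noteq> 0}. Const (c e) * (\<Prod>i\<in>{1..Suc m}. a i ^ e i)) = 0"
      using c(2) by (simp add: M_def)
  qed
qed

section \<open>Dimension\<close>

lemma primeideal_mpoly_ring_rules:
  assumes "primeideal P (mpoly_ring m)"
  shows "0 \<in> P"
    and "p \<in> P \<Longrightarrow> p \<in> carrier (mpoly_ring m)"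
    and "p \<in> P \<Longrightarrow> q \<in> P \<Longrightarrow> p + q \<in> P"
    and "p \<in> P \<Longrightarrow> q \<in> P \<Longrightarrow> p - q \<in> P"
    and "p \<in> P \<Longrightarrow> q \<in> carrier (mpoly_ring m) \<Longrightarrow> q * p \<in> P"
    and "p * q \<in> P \<Longrightarrow> p \<in> carrier (mpoly_ring m) \<Longrightarrow> q \<in> carrier (mpoly_ring m) \<Longrightarrow> p \<in> P \<or> q \<in> P"
    and "1 \<notin> P"
proof -
  interpret primeideal P "mpoly_ring m" by fact
  show "0 \<in> P" using additive_subgroup.zero_closed[OF is_additive_subgroup] by simp
  show carr: "p \<in> P \<Longrightarrow> p \<in> carrier (mpoly_ring m)" for p by (rule Icarr)
  show add: "p \<in> P \<Longrightarrow> q \<in> P \<Longrightarrow> p + q \<in> P" for p q 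
    using additive_subgroup.a_closed[OF is_additive_subgroup, of p q]
    unfolding mpoly_ring_simps(3) .
  show mult: "p \<in> P \<Longrightarrow> q \<in> carrier (mpoly_ring m) \<Longrightarrow> q * p \<in> P" for p q
    using I_l_closed[of p q] by simp
  show "p - q \<in> P" if "p \<in> P" "q \<in> P" for p q
  proof -
    have "(- 1) * q \<in> P"
      using that(2) uminus_in_carrier_mpoly_ring[OF one_in_carrier_mpoly_ring] by (rule mult)
    then show ?thesis using add[OF that(1)] by fastforce
  qed
  show "p * q \<in> P \<Longrightarrow> p \<in> carrier (mpoly_ring m) \<Longrightarrow> q \<in> carrier (mpoly_ring m) \<Longrightarrow> p \<in> P \<or> q \<in> P"
    using I_prime[of p q] unfolding mpoly_ring_simps(2) by blast
  show "1 \<notin> P" using one_imp_carrier I_notcarr by auto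
qed

lemma primeideal_power_mult:
  assumes P: "primeideal P (mpoly_ring m)" and pq: "p ^ e * q \<in> P" "p \<notin> P"
    and "p \<in> carrier (mpoly_ring m)" "q \<in> carrier (mpoly_ring m)"
  shows "q \<in> P"
  using pq(1)
proof (induction e)
  case (Suc e)
  have "p * (p ^ e * q) \<in> P" using Suc.prems by (simp add: mult.assoc)
  then have "p ^ e * q \<in> P"
    using primeideal_mpoly_ring_rules(6)[OF P] assms(3-5) mult_in_carrier_mpoly_ring
      power_in_carrier_mpoly_ring by metis
  then show ?case by (rule Suc.IH)
qed simp

text \<open>
  Suppose a polynomial expression in \<open>a\<^sub>j\<^sub>+\<^sub>1, \<dots>, a\<^sub>d\<close> lies in \<open>P\<^sub>j\<close>.  Factor out the largest power of
  \<open>x = a\<^sub>j\<^sub>+\<^sub>1\<close> dividing it formally, so that it becomes \<open>x ^ \<mu> * (x * U + S)\<close> with \<open>S\<close> a nonzero expression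
  in \<open>a\<^sub>j\<^sub>+\<^sub>2, \<dots>, a\<^sub>d\<close>.  As \<open>x \<notin> P\<^sub>j\<close>, the second factor lies in \<open>P\<^sub>j \<subseteq> P\<^sub>j\<^sub>+\<^sub>1\<close>, and as \<open>x \<in> P\<^sub>j\<^sub>+\<^sub>1\<close>, so does
  \<open>S\<close>.  Repeating this ends with a nonzero constant in \<open>P\<^sub>d\<close>.  The induction therefore runs
  downwards from \<open>j = d\<close>.  Requiring injectivity only of the restrictions to the remaining indices
  lets \<open>E\<close> be cut down to a subset at each step, without changing the exponent functions.
\<close>

lemma chain_elements_algebraically_independent:
  fixes a :: "nat \<Rightarrow> 'k::field mpol"
  assumes chain: "prime_chain (mpoly_ring m) d P"
    and a: "\<And>i. i < d \<Longrightarrow> a (Suc i) \<in> P (Suc i) - P i"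
    and "j \<le> d" "finite E" "E \<noteq> {}" "inj_on (\<lambda>e. restrict e {Suc j..d}) E"
    and "\<And>e. e \<in> E \<Longrightarrow> c e \<noteq> 0"
  shows "(\<Sum>e\<in>E. Const (c e) * (\<Prod>i\<in>{Suc j..d}. a i ^ e i)) \<notin> P j"
  using assms(3-)
proof (induction j arbitrary: E rule: inc_induct)
  case base
  have prime: "primeideal (P d) (mpoly_ring m)" using chain by (simp add: prime_chain_def)
  note P = primeideal_mpoly_ring_rules[OF prime]
  from base obtain e where e: "e \<in> E" by blast
  have "x = e" if "x \<in> E" for x
    using inj_onD[OF base(3) _ that e] by simp
  then have E: "E = {e}" using e by blast
  have "Const (inverse (c e)) * Const (c e) = 1"
    using base(4)[OF e] by (simp flip: Const_mult add: Const_1)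
  then have "Const (c e) \<notin> P d"
    using P(5)[OF _ Const_in_carrier, of "Const (c e)" "inverse (c e)"] P(7) by auto
  then show ?case by (simp add: E)
next
  case (step j)
  have prime: "primeideal (P j) (mpoly_ring m)" "primeideal (P (Suc j)) (mpoly_ring m)"
    and sub: "P j \<subseteq> P (Suc j)"
    using chain step.hyps by (auto simp: prime_chain_def)
  note P = primeideal_mpoly_ring_rules[OF prime(2)]
  have acarr: "a i \<in> carrier (mpoly_ring m)" if "i \<in> {Suc j..d}" for i
  proof -
    have "i - 1 < d" "Suc (i - 1) = i" using that by auto
    then have "a i \<in> P i" "primeideal (P i) (mpoly_ring m)"
      using a[of "i - 1"] that chain by (auto simp: prime_chain_def)
    then show ?thesis using primeideal_mpoly_ring_rules(2) by blast
  qed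
  let ?x = "a (Suc j)"
  have x: "?x \<in> P (Suc j)" "?x \<notin> P j" "?x \<in> carrier (mpoly_ring m)"
    using a[of j] step.hyps acarr[of "Suc j"] by auto
  define M where "M e = Const (c e) * (\<Prod>i\<in>{Suc (Suc j)..d}. a i ^ e i)" for e
  have Mcarr: "M e \<in> carrier (mpoly_ring m)" for e
    unfolding M_def
    by (intro mult_in_carrier_mpoly_ring prod_in_carrier_mpoly_ring power_in_carrier_mpoly_ring
        Const_in_carrier acarr) auto
  define \<mu> where "\<mu> = Min ((\<lambda>e. e (Suc j)) ` E)"
  have \<mu>_le: "\<mu> \<le> e (Suc j)" if "e \<in> E" for e
    using that step.prems(1) by (simp add: \<mu>_def)
  have "\<mu> \<in> (\<lambda>e. e (Suc j)) ` E"
    unfolding \<mu>_def using step.prems by (intro Min_in) auto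
  \<comment> \<open>The terms in which \<open>x\<close> has its least exponent; they make up \<open>S\<close>.\<close>
  define E0 where "E0 = {e \<in> E. e (Suc j) = \<mu>}"
  have E0: "finite E0" "E0 \<noteq> {}" "E0 \<subseteq> E"
    using step.prems(1) \<open>\<mu> \<in> _\<close> by (auto simp: E0_def)
  define S where "S = (\<Sum>e\<in>E0. M e)"
  define U where "U = (\<Sum>e\<in>E - E0. ?x ^ (e (Suc j) - Suc \<mu>) * M e)"
  have Scarr: "S \<in> carrier (mpoly_ring m)"
    unfolding S_def by (intro sum_in_carrier_mpoly_ring Mcarr)
  have Ucarr: "U \<in> carrier (mpoly_ring m)"
    unfolding U_def by (intro sum_in_carrier_mpoly_ring mult_in_carrier_mpoly_ring
        power_in_carrier_mpoly_ring Mcarr x)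
  have "(\<Sum>e\<in>E. Const (c e) * (\<Prod>i\<in>{Suc j..d}. a i ^ e i)) = (\<Sum>e\<in>E. ?x ^ e (Suc j) * M e)"
  proof (rule sum.cong[OF refl])
    fix e
    have "{Suc j..d} = insert (Suc j) {Suc (Suc j)..d}" using step.hyps by auto
    then show "Const (c e) * (\<Prod>i\<in>{Suc j..d}. a i ^ e i) = ?x ^ e (Suc j) * M e"
      by (simp add: M_def mult_ac)
  qed
  also have "\<dots> = (\<Sum>e\<in>E - E0. ?x ^ e (Suc j) * M e) + (\<Sum>e\<in>E0. ?x ^ e (Suc j) * M e)"
    by (rule sum.subset_diff) (use E0 step.prems in auto)
  also have "(\<Sum>e\<in>E0. ?x ^ e (Suc j) * M e) = ?x ^ \<mu> * S"
    by (simp add: S_def sum_distrib_left E0_def)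
  also have "(\<Sum>e\<in>E - E0. ?x ^ e (Suc j) * M e) = ?x ^ \<mu> * (?x * U)"
    unfolding U_def sum_distrib_left
  proof (rule sum.cong[OF refl])
    fix e assume e: "e \<in> E - E0"
    have "e (Suc j) = \<mu> + (1 + (e (Suc j) - Suc \<mu>))" using e \<mu>_le[of e] by (auto simp: E0_def)
    then have "?x ^ e (Suc j) = ?x ^ \<mu> * (?x * ?x ^ (e (Suc j) - Suc \<mu>))"
      by (metis power_add power_one_right)
    then show "?x ^ e (Suc j) * M e = ?x ^ \<mu> * (?x * (?x ^ (e (Suc j) - Suc \<mu>) * M e))"
      by (simp add: mult.assoc)
  qed
  finally have eq: "(\<Sum>e\<in>E. Const (c e) * (\<Prod>i\<in>{Suc j..d}. a i ^ e i)) = ?x ^ \<mu> * (?x * U + S)"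
    by (simp add: algebra_simps)
  \<comment> \<open>All members of \<open>E0\<close> agree at the index \<open>j + 1\<close>, so the other indices still tell them apart.\<close>
  have inj0: "inj_on (\<lambda>e. restrict e {Suc (Suc j)..d}) E0"
  proof (rule inj_onI)
    fix e e' assume e: "e \<in> E0" "e' \<in> E0"
      and r: "restrict e {Suc (Suc j)..d} = restrict e' {Suc (Suc j)..d}"
    have "e i = e' i" if "i \<in> {Suc j..d}" for i
    proof (cases "i = Suc j")
      case True then show ?thesis using e by (simp add: E0_def)
    next
      case False
      then show ?thesis using that fun_cong[OF r, of i] by (simp split: if_splits)
    qed
    then have "restrict e {Suc j..d} = restrict e' {Suc j..d}" by (intro restrict_ext)
    then show "e = e'" using inj_onD[OF step.prems(3)] e E0 by blast
  qed
  have S: "S \<notin> P (Suc j)"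
    unfolding S_def M_def by (rule step.IH[OF E0(1,2) inj0]) (use step.prems(4) E0(3) in blast)
  show ?case
  proof
    assume "(\<Sum>e\<in>E. Const (c e) * (\<Prod>i\<in>{Suc j..d}. a i ^ e i)) \<in> P j"
    then have "?x * U + S \<in> P j"
      unfolding eq by (rule primeideal_power_mult[OF prime(1) _ x(2,3)])
        (intro add_in_carrier_mpoly_ring mult_in_carrier_mpoly_ring x Ucarr Scarr)
    then have "(?x * U + S) - U * ?x \<in> P (Suc j)"
      using sub P(5)[OF x(1) Ucarr] P(4) by blast
    then show False using S by (simp add: mult.commute)
  qed
qed

theorem prime_chain_length_le:
  assumes "prime_chain (mpoly_ring m :: 'k::field mpol ring) d P"
  shows "d \<le> m"
proof (rule ccontr)
  assume "\<not> d \<le> m"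
  then have chain: "prime_chain (mpoly_ring m) (Suc m) P"
    using assms by (auto simp: prime_chain_def)
  then have "\<forall>i. \<exists>x. i < Suc m \<longrightarrow> x \<in> P (Suc i) - P i"
    by (auto simp: prime_chain_def)
  then obtain f where f: "\<And>i. i < Suc m \<Longrightarrow> f i \<in> P (Suc i) - P i" by metis
  define a where "a i = f (i - 1)" for i
  have a: "a (Suc i) \<in> P (Suc i) - P i" if "i < Suc m" for i
    using f[OF that] by (simp add: a_def)
  have acarr: "a i \<in> carrier (mpoly_ring m)" if "i \<in> {1..Suc m}" for i
  proof -
    have "a i \<in> P i" using a[of "i - 1"] that by auto
    moreover have "primeideal (P i) (mpoly_ring m)" using chain that by (simp add: prime_chain_def)
    ultimately show ?thesis using primeideal_mpoly_ring_rules(2) by blast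
  qed
  obtain E :: "(nat \<Rightarrow> nat) set" and c where
    E: "finite E" "E \<noteq> {}" "inj_on (\<lambda>e. restrict e {1..Suc m}) E" "\<forall>e\<in>E. c e \<noteq> 0"
    and sum: "(\<Sum>e\<in>E. Const (c e) * (\<Prod>i\<in>{1..Suc m}. a i ^ e i)) = 0"
    by (rule algebraic_dependence[OF acarr])
  have "(\<Sum>e\<in>E. Const (c e) * (\<Prod>i\<in>{Suc 0..Suc m}. a i ^ e i)) \<notin> P 0"
    by (rule chain_elements_algebraically_independent[OF chain a _ E(1,2) _ E(4)[rule_format]])
      (use E(3) in \<open>simp_all only: One_nat_def le0\<close>)
  then have "0 \<notin> P 0" using sum by simp
  moreover have "primeideal (P 0) (mpoly_ring m)" using chain by (simp add: prime_chain_def)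
  ultimately show False using primeideal_mpoly_ring_rules(1) by blast
qed

section \<open>Ideals generated by variables\<close>

text \<open>
  The ideal \<open>(x\<^sub>i : i \<in> S)\<close>, described through monomials: every monomial of a member involves a variable
  from \<open>S\<close>.  Unlike the description by generators this makes membership immediate to test.
\<close>

definition var_ideal :: "nat \<Rightarrow> nat set \<Rightarrow> 'k::field mpol set" where
  "var_ideal m S =
     {p \<in> carrier (mpoly_ring m). \<forall>t\<in>Poly_Mapping.keys p. Poly_Mapping.keys t \<inter> S \<noteq> {}}"

lemma keys_monomial_add:
  "Poly_Mapping.keys (s + t) = Poly_Mapping.keys s \<union> Poly_Mapping.keys t" for s t :: "nat \<Rightarrow>\<^sub>0 nat"
  by (auto simp: in_keys_iff lookup_add)

lemma var_ideal_add: "p \<in> var_ideal m S \<Longrightarrow> q \<in> var_ideal m S \<Longrightarrow> p + q \<in> var_ideal m S"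
  using add_in_carrier_mpoly_ring[of p m q] Poly_Mapping.keys_add[of p q]
  unfolding var_ideal_def by blast

lemma var_ideal_mult:
  assumes "p \<in> var_ideal m S" "q \<in> carrier (mpoly_ring m)"
  shows "q * p \<in> var_ideal m S"
proof -
  have "Poly_Mapping.keys t \<inter> S \<noteq> {}" if "t \<in> Poly_Mapping.keys (q * p)" for t
    using that keys_mult[of q p] assms(1) unfolding var_ideal_def
    by (fastforce simp: keys_monomial_add)
  then show ?thesis
    using assms mult_in_carrier_mpoly_ring[of q m p] unfolding var_ideal_def by blast
qed

lemma X_in_var_ideal_iff: "i \<in> {1..m} \<Longrightarrow> X i \<in> var_ideal m S \<longleftrightarrow> i \<in> S"
  by (simp add: var_ideal_def X_def)

lemma ideal_var_ideal: "ideal (var_ideal m S :: 'k::field mpol set) (mpoly_ring m)"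
proof (rule idealI)
  interpret cring "mpoly_ring m :: 'k mpol ring" by (rule cring_mpoly_ring)
  show "ring (mpoly_ring m :: 'k mpol ring)" by (rule ring_axioms)
  have inv: "\<ominus>\<^bsub>mpoly_ring m\<^esub> p = - p" if "p \<in> carrier (mpoly_ring m)" for p :: "'k mpol"
    using minus_equality[of "- p" p] uminus_in_carrier_mpoly_ring[OF that] that by simp
  show "subgroup (var_ideal m S :: 'k mpol set) (add_monoid (mpoly_ring m))"
  proof (rule add.subgroupI)
    show "var_ideal m S \<subseteq> carrier (mpoly_ring m)" by (auto simp: var_ideal_def)
    have "(0 :: 'k mpol) \<in> var_ideal m S" by (simp add: var_ideal_def)
    then show "(var_ideal m S :: 'k mpol set) \<noteq> {}" by blast
  next
    fix p :: "'k mpol" assume p: "p \<in> var_ideal m S"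
    have "(- 1) * p \<in> var_ideal m S"
      by (rule var_ideal_mult[OF p uminus_in_carrier_mpoly_ring[OF one_in_carrier_mpoly_ring]])
    then show "\<ominus>\<^bsub>mpoly_ring m\<^esub> p \<in> var_ideal m S"
      using inv[of p] p by (simp add: var_ideal_def)
  next
    fix p q :: "'k mpol" assume "p \<in> var_ideal m S" "q \<in> var_ideal m S"
    then show "p \<oplus>\<^bsub>mpoly_ring m\<^esub> q \<in> var_ideal m S" using var_ideal_add[of p m S q] by simp
  qed
next
  fix p q :: "'k mpol" assume pq: "p \<in> var_ideal m S" "q \<in> carrier (mpoly_ring m)"
  show "q \<otimes>\<^bsub>mpoly_ring m\<^esub> p \<in> var_ideal m S" using var_ideal_mult[OF pq] by simp
  show "p \<otimes>\<^bsub>mpoly_ring m\<^esub> q \<in> var_ideal m S" using var_ideal_mult[OF pq] by (simp add: mult.commute)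
qed

text \<open>
  The value of \<open>p\<close> at \<open>x\<^sub>i = 0\<close> for \<open>i \<in> S\<close>, that is, the representative of \<open>p\<close> modulo \<open>(x\<^sub>i : i \<in> S)\<close> that is
  free of the variables in \<open>S\<close>.
\<close>

definition drop_vars :: "nat set \<Rightarrow> 'k::field mpol \<Rightarrow> 'k mpol" where
  "drop_vars S p =
     (\<Sum>t\<in>{t \<in> Poly_Mapping.keys p. Poly_Mapping.keys t \<inter> S = {}}.
        Poly_Mapping.single t (Poly_Mapping.lookup p t))"

lemma lookup_drop_vars:
  "Poly_Mapping.lookup (drop_vars S p) t =
     (if Poly_Mapping.keys t \<inter> S = {} then Poly_Mapping.lookup p t else 0)"
  by (auto simp: drop_vars_def lookup_sum lookup_single when_def in_keys_iff sum.delta' sum.delta)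

text \<open>
  Modulo the ideal, \<open>p\<close> and \<open>q\<close> may be replaced by their parts \<open>p0\<close> and \<open>q0\<close> free of the variables in \<open>S\<close>.
  The product \<open>p0 * q0\<close> is again free of them, so it lies in the ideal only if it vanishes, and
  polynomials have no zero divisors.
\<close>

lemma primeideal_var_ideal: "primeideal (var_ideal m S :: 'k::field mpol set) (mpoly_ring m)"
proof (rule primeidealI[OF ideal_var_ideal cring_mpoly_ring])
  have "(1 :: 'k mpol) \<in> carrier (mpoly_ring m)" "(1 :: 'k mpol) \<notin> var_ideal m S"
    by (auto simp: var_ideal_def)
  then show "carrier (mpoly_ring m) \<noteq> (var_ideal m S :: 'k mpol set)" by blast
next
  fix p q :: "'k mpol"
  assume p: "p \<in> carrier (mpoly_ring m)" and q: "q \<in> carrier (mpoly_ring m)"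
    and "p \<otimes>\<^bsub>mpoly_ring m\<^esub> q \<in> var_ideal m S"
  then have pq: "Poly_Mapping.keys t \<inter> S \<noteq> {}" if "t \<in> Poly_Mapping.keys (p * q)" for t
    using that by (simp add: var_ideal_def)
  define p0 q0 where "p0 = drop_vars S p" and "q0 = drop_vars S q"
  have keys0: "Poly_Mapping.keys t \<inter> S = {}"
    if "t \<in> Poly_Mapping.keys p0 \<or> t \<in> Poly_Mapping.keys q0" for t
    using that by (auto simp: p0_def q0_def in_keys_iff lookup_drop_vars split: if_splits)
  have keys1: "Poly_Mapping.keys t \<inter> S \<noteq> {}"
    if "t \<in> Poly_Mapping.keys (p - p0) \<or> t \<in> Poly_Mapping.keys (q - q0)" for t
    using that by (auto simp: p0_def q0_def in_keys_iff lookup_drop_vars lookup_minus split: if_splits)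
  have "p0 * q0 = 0"
  proof (rule ccontr)
    assume "p0 * q0 \<noteq> 0"
    then obtain t where t: "t \<in> Poly_Mapping.keys (p0 * q0)"
      by (metis all_not_in_conv keys_eq_empty)
    then have tS: "Poly_Mapping.keys t \<inter> S = {}"
      using keys_mult[of p0 q0] keys0 by (fastforce simp: keys_monomial_add)
    have "t \<notin> Poly_Mapping.keys ((p - p0) * q)" "t \<notin> Poly_Mapping.keys (p0 * (q - q0))"
      using keys_mult[of "p - p0" q] keys_mult[of p0 "q - q0"] keys1 tS
      by (fastforce simp: keys_monomial_add)+
    moreover have "p * q = p0 * q0 + (p - p0) * q + p0 * (q - q0)"
      by (simp add: algebra_simps)
    ultimately have "t \<in> Poly_Mapping.keys (p * q)"
      using t by (simp add: in_keys_iff lookup_add)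
    then show False using pq tS by blast
  qed
  then have "p0 = 0 \<or> q0 = 0" by simp
  then show "p \<in> var_ideal m S \<or> q \<in> var_ideal m S"
    using keys1 p q by (auto simp: var_ideal_def simp del: mpoly_ring_simps(1))
qed

lemma var_ideal_subset:
  assumes Q: "primeideal Q (mpoly_ring m :: 'k::field mpol ring)"
    and S: "\<And>i. i \<in> S \<Longrightarrow> X i \<in> Q"
  shows "var_ideal m S \<subseteq> Q"
proof
  note rules = primeideal_mpoly_ring_rules[OF Q]
  fix p :: "'k mpol" assume p: "p \<in> var_ideal m S"
  have terms: "Poly_Mapping.single t (Poly_Mapping.lookup p t) \<in> Q" if t: "t \<in> Poly_Mapping.keys p" for t
  proof -
    obtain i where i: "i \<in> Poly_Mapping.keys t" "i \<in> S"
      using p t unfolding var_ideal_def by blast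
    define s where "s = t - Poly_Mapping.single i 1"
    have ts: "t = s + Poly_Mapping.single i 1"
      using i(1) by (intro poly_mapping_eqI)
        (auto simp: s_def lookup_add lookup_minus lookup_single when_def in_keys_iff)
    have "Poly_Mapping.keys t \<subseteq> {1..m}"
      using p t unfolding var_ideal_def mpoly_ring_simps by blast
    then have "Poly_Mapping.keys s \<subseteq> {1..m}"
      by (metis Un_subset_iff keys_monomial_add ts)
    then have "Poly_Mapping.single s (Poly_Mapping.lookup p t) * X i \<in> Q"
      using S[OF i(2)] by (intro rules(5)) auto
    moreover have "Poly_Mapping.single s (Poly_Mapping.lookup p t) * X i =
        Poly_Mapping.single t (Poly_Mapping.lookup p t)"
      by (simp add: X_def mult_single ts)
    ultimately show ?thesis by simp
  qed
  have sum: "(\<Sum>t\<in>A. f t) \<in> Q" if "\<And>t. t \<in> A \<Longrightarrow> f t \<in> Q" for A and f :: "(nat \<Rightarrow>\<^sub>0 nat) \<Rightarrow> 'k mpol"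
    using that by (induction A rule: infinite_finite_induct) (auto intro: rules)
  have "(\<Sum>t\<in>Poly_Mapping.keys p. Poly_Mapping.single t (Poly_Mapping.lookup p t)) \<in> Q"
    by (rule sum[OF terms])
  then show "p \<in> Q" by (simp flip: mpol_as_sum)
qed

lemma var_ideal_psubset:
  assumes "i \<in> {1..m}" "i \<notin> S"
  shows "(var_ideal m S :: 'k::field mpol set) \<subset> var_ideal m (insert i S)"
proof -
  have "X i \<in> (var_ideal m (insert i S) :: 'k mpol set)" "X i \<notin> (var_ideal m S :: 'k mpol set)"
    using assms X_in_var_ideal_iff by auto
  moreover have "(var_ideal m S :: 'k mpol set) \<subseteq> var_ideal m (insert i S)"
    unfolding var_ideal_def by auto
  ultimately show ?thesis by blast
qed

text \<open>
  Removing the variables of \<open>S\<close> one at a time gives the new members of the chain.  The top is kept, so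
  that the statement bounds both the height of a prime and the length of a chain above it.
\<close>

lemma prime_chain_below:
  assumes "finite S" "S \<subseteq> {1..m}" "prime_chain (mpoly_ring m :: 'k::field mpol ring) d P"
    and "\<And>i. i \<in> S \<Longrightarrow> X i \<in> P 0"
  shows "\<exists>P'. prime_chain (mpoly_ring m :: 'k mpol ring) (d + card S) P' \<and> P' (d + card S) = P d"
  using assms
proof (induction S arbitrary: d P)
  case empty
  then show ?case by auto
next
  case (insert x S)
  \<comment> \<open>\<open>P 0\<close> contains \<open>x\<close>, so the ideal of the remaining variables is strictly smaller and can be put
    in front; the rest of \<open>S\<close> is then handled by the induction hypothesis.\<close>
  let ?P = "\<lambda>i. if i = 0 then var_ideal m S else P (i - 1)"
  have prime: "primeideal (P 0) (mpoly_ring m)" using insert.prems by (simp add: prime_chain_def)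
  have "var_ideal m S \<subset> P 0"
  proof -
    have "X x \<notin> var_ideal m S" using insert.hyps insert.prems(1) by (subst X_in_var_ideal_iff) auto
    then show ?thesis using var_ideal_subset[OF prime, of S] insert.prems(3) by blast
  qed
  then have "?P i \<subset> ?P (Suc i)" if "i < Suc d" for i
    using insert.prems(2) that by (cases i) (simp_all add: prime_chain_def)
  moreover have "primeideal (?P i) (mpoly_ring m)" if "i \<le> Suc d" for i
    using insert.prems(2) that primeideal_var_ideal by (cases i) (simp_all add: prime_chain_def)
  ultimately have "prime_chain (mpoly_ring m) (Suc d) ?P"
    unfolding prime_chain_def by blast
  moreover have "X i \<in> ?P 0" if "i \<in> S" for i
    using that insert.prems(1) by (auto simp: X_in_var_ideal_iff)
  ultimately have "\<exists>P'. prime_chain (mpoly_ring m :: 'k mpol ring) (Suc d + card S) P' \<and>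
      P' (Suc d + card S) = ?P (Suc d)"
    using insert.prems(1) by (intro insert.IH) auto
  then show ?case using insert.hyps by simp
qed


section \<open>The ideal of the increasing images of a path\<close>

lemma edge_ideal_subset_carrier:
  "(edge_ideal n (line_graph n) :: 'k::field mpol set) \<subseteq> carrier (mpoly_ring n)"
proof -
  interpret cring "mpoly_ring n :: 'k mpol ring" by (rule cring_mpoly_ring)
  have gens: "({X i * X (i + 1) | i. 1 \<le> i \<and> i \<le> n - 1} :: 'k mpol set) \<subseteq> carrier (mpoly_ring n)"
    by (auto intro!: mult_in_carrier_mpoly_ring X_in_carrier_mpoly_ring simp del: mpoly_ring_simps(1))
  show ?thesis
    unfolding edge_ideal_line_graph
    by (rule genideal_minimal[OF oneideal gens])
qed

text \<open>
  The increasing map sends \<open>1, \<dots>, i\<close> to the block of consecutive numbers ending at \<open>a\<close> and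
  \<open>i + 1, \<dots>, n\<close> to the block starting at \<open>b\<close>.  The second block ends at \<open>b + n - i - 1\<close>, so it stays
  within \<open>m\<close> if \<open>i \<ge> b + n - m - 1\<close>, and the first one starts at a positive number if \<open>i \<le> a\<close>; the
  distance condition makes these compatible.
\<close>

lemma X_mult_X_in_line_orbit:
  fixes n m a b :: nat
  assumes "2 \<le> n" "n \<le> m" "1 \<le> a" "a < b" "b \<le> m" "b - a \<le> m - n + 1"
  shows "X a * X b \<in> (Inc_ideal n m (edge_ideal n (line_graph n)) :: 'k::field mpol set)"
proof -
  interpret Rn: cring "mpoly_ring n :: 'k mpol ring" by (rule cring_mpoly_ring)
  interpret Rm: cring "mpoly_ring m :: 'k mpol ring" by (rule cring_mpoly_ring)
  define i where "i = max 1 (b + n - m - 1)"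
  have i: "1 \<le> i" "i \<le> a" "i \<le> n - 1" "b + n \<le> m + i + 1"
    using assms by (auto simp: i_def)
  define \<pi> where "\<pi> = (\<lambda>j\<in>{1..n}. if j \<le> i then a - i + j else b + (j - i - 1))"
  have "\<pi> \<in> {1..n} \<rightarrow>\<^sub>E {1..m}"
    unfolding \<pi>_def using assms i by (intro PiE_I) auto
  moreover have "strict_mono_on {1..n} \<pi>"
    by (rule strict_mono_onI) (use assms i in \<open>auto simp: \<pi>_def\<close>)
  ultimately have \<pi>: "\<pi> \<in> Inc n m" by (simp add: Inc_def)
  have \<pi>i: "\<pi> i = a" "\<pi> (i + 1) = b" using i assms by (auto simp: \<pi>_def)
  have "(X i * X (i + 1) :: 'k mpol) \<in> edge_ideal n (line_graph n)"
  proof -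
    have "({X i * X (i + 1) | i. 1 \<le> i \<and> i \<le> n - 1} :: 'k mpol set) \<subseteq> carrier (mpoly_ring n)"
      using assms(1) by (auto intro!: mult_in_carrier_mpoly_ring X_in_carrier_mpoly_ring
          simp del: mpoly_ring_simps(1))
    then show ?thesis
      unfolding edge_ideal_line_graph using Rn.genideal_self i by blast
  qed
  then have "subst_vars \<pi> (X i * X (i + 1)) \<in> (\<Union>\<pi>\<in>Inc n m. subst_vars \<pi> ` (edge_ideal n (line_graph n) :: 'k mpol set))"
    using \<pi> by blast
  moreover have "(\<Union>\<pi>\<in>Inc n m. subst_vars \<pi> ` (edge_ideal n (line_graph n) :: 'k mpol set)) \<subseteq> carrier (mpoly_ring m)"
    using subst_vars_in_carrier edge_ideal_subset_carrier by blast
  ultimately have "subst_vars \<pi> (X i * X (i + 1)) \<in> (Inc_ideal n m (edge_ideal n (line_graph n)) :: 'k mpol set)"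
    unfolding Inc_ideal_def using Rm.genideal_self by blast
  then show ?thesis by (simp add: subst_vars_mult \<pi>i flip: One_nat_def)
qed

lemma ideal_Inc_ideal:
  "ideal (Inc_ideal n m (edge_ideal n (line_graph n)) :: 'k::field mpol set) (mpoly_ring m)"
proof -
  interpret cring "mpoly_ring m :: 'k mpol ring" by (rule cring_mpoly_ring)
  show ?thesis
    unfolding Inc_ideal_def
    by (rule genideal_ideal) (use subst_vars_in_carrier edge_ideal_subset_carrier in blast)
qed

text \<open>
  An increasing image of an edge of the path is never \<open>{1, m}\<close>: for \<open>n \<ge> 3\<close> the path has
  a vertex before or after the edge, whose image would have to lie below \<open>1\<close> or above \<open>m\<close>.  So every generator involves a
  variable other than \<open>x\<^sub>1\<close> and \<open>x\<^sub>m\<close>.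
\<close>

lemma line_orbit_subset_var_ideal:
  assumes "3 \<le> n"
  shows "(Inc_ideal n m (edge_ideal n (line_graph n)) :: 'k::field mpol set) \<subseteq>
    var_ideal m ({1..m} - {1, m})"
    (is "?J \<subseteq> ?V")
proof -
  interpret Rn: cring "mpoly_ring n :: 'k mpol ring" by (rule cring_mpoly_ring)
  interpret Rm: cring "mpoly_ring m :: 'k mpol ring" by (rule cring_mpoly_ring)
  have "subst_vars \<pi> p \<in> ?V"
    if \<pi>: "\<pi> \<in> Inc n m" and p: "p \<in> edge_ideal n (line_graph n)" for \<pi> and p :: "'k mpol"
  proof -
    interpret h: ring_hom_ring "mpoly_ring n :: 'k mpol ring" "mpoly_ring m" "subst_vars \<pi>"
      by (rule ring_hom_ringI2[OF Rn.ring_axioms Rm.ring_axioms subst_vars_ring_hom[OF \<pi>]])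
    \<comment> \<open>The preimage of the ideal is an ideal, so only generators have to be looked at.\<close>
    let ?K = "{p \<in> carrier (mpoly_ring n). subst_vars \<pi> p \<in> ?V}"
    have "X i * X (i + 1) \<in> ?K" if i: "1 \<le> i" "i \<le> n - 1" for i
    proof -
      have i': "i \<in> {1..n}" "i + 1 \<in> {1..n}" using i assms by auto
      then have r: "\<pi> i \<in> {1..m}" "\<pi> (i + 1) \<in> {1..m}"
        using \<pi> by (auto simp: Inc_def PiE_iff)
      have mono: "\<pi> x < \<pi> y" if "x \<in> {1..n}" "y \<in> {1..n}" "x < y" for x y
        using \<pi> strict_mono_onD[of "{1..n}" \<pi> x y] that by (simp add: Inc_def)
      have r': "\<pi> 1 \<in> {1..m}" "\<pi> n \<in> {1..m}"
        using \<pi> assms by (auto simp: Inc_def PiE_iff)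
      have "\<pi> i \<notin> {1, m} \<or> \<pi> (i + 1) \<notin> {1, m}"
      proof (cases "i = 1")
        case True
        then have "\<pi> (i + 1) < \<pi> n" "\<pi> i < \<pi> (i + 1)" using mono i' assms by auto
        then show ?thesis using r r' by auto
      next
        case False
        then have "\<pi> 1 < \<pi> i" "\<pi> i < \<pi> (i + 1)" using mono[of 1 i] mono i i' by auto
        then show ?thesis using r r' by auto
      qed
      then have "X (\<pi> i) \<in> ?V \<or> X (\<pi> (i + 1)) \<in> ?V"
        using r X_in_var_ideal_iff by blast
      then have "X (\<pi> i) * X (\<pi> (i + 1)) \<in> ?V"
        using var_ideal_mult X_in_carrier_mpoly_ring r by (metis mult.commute)
      moreover have "X i * X (i + 1) \<in> carrier (mpoly_ring n)"
        by (intro mult_in_carrier_mpoly_ring X_in_carrier_mpoly_ring i')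
      ultimately show ?thesis
        by (simp add: subst_vars_mult del: mpoly_ring_simps(1))
    qed
    then have gens: "{X i * X (i + 1) | i. 1 \<le> i \<and> i \<le> n - 1} \<subseteq> ?K" by blast
    have "edge_ideal n (line_graph n) \<subseteq> ?K"
      unfolding edge_ideal_line_graph
      by (rule Rn.genideal_minimal[OF h.ideal_vimage[OF ideal_var_ideal] gens])
    then show ?thesis using p by blast
  qed
  then show ?thesis
    unfolding Inc_ideal_def by (intro Rm.genideal_minimal ideal_var_ideal) blast
qed

text \<open>
  The indices of the variables outside a prime containing \<open>J\<close> are pairwise at distance at least
  \<open>r + 2\<close>.  Three of them would span a distance of at least \<open>2 r + 4\<close>, which exceeds \<open>n + r - 1\<close>
  because \<open>r \<ge> n - 4\<close>.
\<close>

lemma many_variables_in_prime_above: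
  fixes Q :: "'k::field mpol set"
  assumes n: "5 \<le> n" and r: "n - 4 \<le> r"
    and Q: "primeideal Q (mpoly_ring (n + r))"
    and JQ: "Inc_ideal n (n + r) (edge_ideal n (line_graph n)) \<subseteq> Q"
  obtains S where "S \<subseteq> {1..n + r}" "card S = n + r - 2" "\<And>i. i \<in> S \<Longrightarrow> X i \<in> Q"
proof -
  define T where "T = {i \<in> {1..n + r}. X i \<notin> Q}"
  have T: "T \<subseteq> {1..n + r}" "finite T" by (auto simp: T_def)
  have far: "r + 2 \<le> b - a" if "a \<in> T" "b \<in> T" "a < b" for a b
  proof (rule ccontr)
    assume "\<not> r + 2 \<le> b - a"
    then have "(X a * X b :: 'k mpol) \<in> Inc_ideal n (n + r) (edge_ideal n (line_graph n))"
      using that T n by (intro X_mult_X_in_line_orbit) auto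
    then have "X a * X b \<in> Q" using JQ by blast
    moreover have "X a \<in> carrier (mpoly_ring (n + r))" "X b \<in> carrier (mpoly_ring (n + r))"
      using that T X_in_carrier_mpoly_ring by blast+
    ultimately have "X a \<in> Q \<or> X b \<in> Q" using primeideal_mpoly_ring_rules(6)[OF Q] by blast
    then show False using that by (simp add: T_def)
  qed
  have "card T \<le> 2"
  proof (cases "T = {}")
    case False
    have "T \<subseteq> {Min T, Max T}"
    proof (rule ccontr)
      assume "\<not> T \<subseteq> {Min T, Max T}"
      then obtain b where b: "b \<in> T" "b \<noteq> Min T" "b \<noteq> Max T" by blast
      have MM: "Min T \<in> T" "Max T \<in> T" using False T by auto
      have "Min T < b" "b < Max T"
        using b T by (auto simp: less_le)
      then have "r + 2 \<le> b - Min T" "r + 2 \<le> Max T - b"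
        using far b(1) MM by blast+
      moreover have "1 \<le> Min T" "Max T \<le> n + r" using MM T by auto
      ultimately show False using r by linarith
    qed
    then have "card T \<le> card {Min T, Max T}" by (intro card_mono) auto
    also have "\<dots> \<le> 2" by (simp add: card_insert_if)
    finally show ?thesis .
  qed simp
  then have "n + r - 2 \<le> card ({1..n + r} - T)"
    using T by (simp add: card_Diff_subset)
  then obtain S where "S \<subseteq> {1..n + r} - T" "card S = n + r - 2"
    by (meson obtain_subset_with_card_n)
  then show thesis by (intro that[of S]) (auto simp: T_def)
qed

section \<open>Height and dimension\<close>

theorem proposition3p5:
  fixes n r :: nat
    and I J :: "'k::field mpol set"
  assumes "n \<ge> 5" and "r \<ge> n - 4"
    and "I = edge_ideal n (line_graph n)"
    and "J = Inc_ideal n (n + r) I"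
  shows "ideal_height (mpoly_ring (n + r)) J = enat (n + r - 2) \<and>
    krull_dim (mpoly_ring (n + r) Quot J) = 2"
proof -
  define m where "m = n + r"
  let ?R = "mpoly_ring m :: 'k mpol ring"
  interpret cring ?R by (rule cring_mpoly_ring)
  have J: "J = Inc_ideal n m (edge_ideal n (line_graph n))"
    using assms(3,4) by (simp add: m_def)
  have m: "m \<ge> 5" using assms(1) by (simp add: m_def)
  have idealJ: "ideal J ?R" unfolding J by (rule ideal_Inc_ideal)
  \<comment> \<open>The chain \<open>?V S \<subset> ?V (insert 1 S) \<subset> ?V (insert m (insert 1 S))\<close> serves twice: as the continuation of chains ending in
    \<open>?V S\<close>, and as a chain of length 2 above \<open>J\<close>.\<close>
  define S where "S = {1..m} - {1, m}"
  let ?V = "var_ideal m :: nat set \<Rightarrow> 'k mpol set"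
  have JV: "J \<subseteq> ?V S"
    unfolding J S_def using assms(1) by (intro line_orbit_subset_var_ideal) simp
  have V1: "?V S \<subset> ?V (insert 1 S)" and V2: "?V (insert 1 S) \<subset> ?V (insert m (insert 1 S))"
    using m by (auto intro!: var_ideal_psubset simp: S_def)
  have prime_V: "primeideal (?V T) ?R" for T by (rule primeideal_var_ideal)

  have above: "\<exists>P'. prime_chain ?R (d + (m - 2)) P' \<and> P' (d + (m - 2)) = P d"
    if P: "prime_chain ?R d P" and "J \<subseteq> P 0" for d P
  proof -
    have prime: "primeideal (P 0) ?R" using P by (simp add: prime_chain_def)
    obtain S' where S': "S' \<subseteq> {1..m}" "card S' = m - 2" "\<And>i. i \<in> S' \<Longrightarrow> X i \<in> P 0"
      using many_variables_in_prime_above[OF assms(1,2) prime[unfolded m_def]]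
        \<open>J \<subseteq> P 0\<close>[unfolded J] unfolding m_def by blast
    have "finite S'" using S'(1) finite_subset by blast
    from prime_chain_below[OF this S'(1) P S'(3)] show ?thesis unfolding S'(2) .
  qed

  have "ideal_height ?R J = enat (m - 2)"
  proof (rule antisym)
    have "prime_height ?R (?V S) \<le> enat (m - 2)"
      unfolding prime_height_def
    proof (rule SUP_least, clarsimp)
      fix d P assume P: "prime_chain ?R d P" and top: "P d = ?V S"
      define P' where "P' i = (if i \<le> d then P i else if i = Suc d then ?V (insert 1 S)
          else ?V (insert m (insert 1 S)))" for i
      have "prime_chain ?R (d + 2) P'"
        unfolding prime_chain_def
      proof (intro conjI allI impI)
        show "primeideal (P' i) ?R" for i
          using P prime_V by (simp add: P'_def prime_chain_def)
        show "P' i \<subset> P' (Suc i)" if lt: "i < d + 2" for i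
        proof -
          consider "i < d" | "i = d" | "i = Suc d" using lt by linarith
          then show ?thesis
            using P V1 V2 top by cases (auto simp: P'_def prime_chain_def)
        qed
      qed
      then have "d + 2 \<le> m" by (rule prime_chain_length_le)
      then show "d \<le> m - 2" by simp
    qed
    then show "ideal_height ?R J \<le> enat (m - 2)"
      unfolding ideal_height_def using JV prime_V by (intro INF_lower2[of "?V S"]) auto
    show "enat (m - 2) \<le> ideal_height ?R J"
      unfolding ideal_height_def
    proof (rule INF_greatest)
      fix Q assume "Q \<in> {Q. primeideal Q ?R \<and> J \<subseteq> Q}"
      then have "prime_chain ?R 0 (\<lambda>_. Q)" "J \<subseteq> Q" by (auto simp: prime_chain_def)
      from above[OF this] show "enat (m - 2) \<le> prime_height ?R Q"
        unfolding prime_height_def by (intro SUP_upper) auto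
    qed
  qed
  moreover have "krull_dim (?R Quot J) = 2"
  proof (rule antisym)
    show "krull_dim (?R Quot J) \<le> 2"
      unfolding krull_dim_def prime_chain_quot_iff[OF idealJ]
    proof (rule SUP_least, clarify)
      fix d P assume "prime_chain ?R d P" "J \<subseteq> P 0"
      from above[OF this] have "d + (m - 2) \<le> m" using prime_chain_length_le by blast
      then have "d \<le> 2" using m by simp
      then show "enat d \<le> 2" by (simp add: numeral_eq_enat)
    qed
    let ?P = "\<lambda>i::nat. if i = 0 then ?V S else if i = 1 then ?V (insert 1 S)
        else ?V (insert m (insert 1 S))"
    have "prime_chain ?R 2 ?P"
      using V1 V2 prime_V by (auto simp: prime_chain_def less_2_cases_iff)
    then have "\<exists>P. prime_chain ?R 2 P \<and> J \<subseteq> P 0"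
      using JV by (intro exI[of _ ?P]) simp
    then show "2 \<le> krull_dim (?R Quot J)"
      unfolding krull_dim_def prime_chain_quot_iff[OF idealJ] numeral_eq_enat
      by (intro SUP_upper) simp
  qed
  ultimately show ?thesis by (simp add: m_def)
qed

end
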